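(* Let $\alpha\ge-\frac12$. For $\lambda\in\mathbb{C}$, the $q$-differential-difference problem $$\Lambda_{\alpha,q}(f)=i\lambda f,\qquad f(0)=1,$$ has as unique solution the function $$\psi_\lambda^{\alpha,q}:x\longmapsto j_\alpha(\lambda x;q^2)+\frac{i\lambda x}{[2\alpha+2]_q}\,j_{\alpha+1}(\lambda x;q^2).$$
   Context: Standing assumptions: $q\in(0,1)$ and $\frac{\log(1-q)}{\log q}\in 2\mathbb{Z}$. $\mathbb{R}_q=\{\pm q^n: n\in\mathbb{Z}\}$. Here $f$ is a complex-valued function on $\mathbb{R}_q$ having a limit at $0$ in $\mathbb{R}_q$, and $f(0)$ denotes $\lim_{x\to0,\,x\in\mathbb{R}_q}f(x)$; $f_e,f_o$ are the even and odd parts of $f$. Notation: $(a;q)_\infty=\prod_{k\ge0}(1-aq^k)$, $[x]_q=\frac{1-q^x}{1-q}$, $\Gamma_{q^2}(x)=\frac{(q^2;q^2)_\infty}{(q^{2x};q^2)_\infty}(1-q^2)^{1-x}$. For $z\neq0$, $\partial_q f(z)=\frac{f(q^{-1}z)+f(-q^{-1}z)-f(qz)+f(-qz)-2f(-z)}{2(1-q)z}$. $q$-Dunkl operator: $\Lambda_{\alpha,q}(f)(x)=\partial_q[H_{\alpha,q}(f)](x)+[2\alpha+1]_q\frac{f(x)-f(-x)}{2x}$, where $H_{\alpha,q}(f)=f_e+q^{2\alpha+1}f_o$. Normalized $q$-Bessel function: $j_\alpha(x;q^2)=\sum_{n\ge0}(-1)^n\frac{\Gamma_{q^2}(\alpha+1)q^{n(n+1)}}{\Gamma_{q^2}(\alpha+n+1)\Gamma_{q^2}(n+1)}\left(\frac{x}{1+q}\right)^{2n}$.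 *)

theory Defs
  imports "HOL-Analysis.Analysis"
begin

definition Rq :: "real \<Rightarrow> real set" where
  "Rq q = {x. \<exists>n::int. x = q powi n \<or> x = - (q powi n)}"

definition q_poch_inf :: "real \<Rightarrow> real \<Rightarrow> real" where
  "q_poch_inf a q = (\<Prod>k. 1 - a * q ^ k)"

definition q_number :: "real \<Rightarrow> real \<Rightarrow> real" where
  "q_number q x = (1 - q powr x) / (1 - q)"

text \<open>The base is a parameter: \<open>\<Gamma>\<close> with base \<open>q\<^sup>2\<close> is \<open>q_Gamma (q\<^sup>2)\<close>.\<close>

definition q_Gamma :: "real \<Rightarrow> real \<Rightarrow> real" where
  "q_Gamma p x = q_poch_inf p p / q_poch_inf (p powr x) p * (1 - p) powr (1 - x)"

text \<open>
  Functions on \<open>Rq q\<close> are represented by total functions on the reals; the set \<open>Rq q\<close> is closed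
  under negation and under multiplication by \<open>q\<close> and \<open>1 / q\<close>, so at points of \<open>Rq q\<close> the
  operators below only involve the values of \<open>f\<close> on \<open>Rq q\<close>.
\<close>

definition even_part :: "(real \<Rightarrow> complex) \<Rightarrow> real \<Rightarrow> complex" where
  "even_part f x = (f x + f (- x)) / 2"

definition odd_part :: "(real \<Rightarrow> complex) \<Rightarrow> real \<Rightarrow> complex" where
  "odd_part f x = (f x - f (- x)) / 2"

definition q_deriv :: "real \<Rightarrow> (real \<Rightarrow> complex) \<Rightarrow> real \<Rightarrow> complex" where
  "q_deriv q f z =
     (f (inverse q * z) + f (- (inverse q * z)) - f (q * z) + f (- (q * z)) - 2 * f (- z))
       / of_real (2 * (1 - q) * z)"

definition q_dunkl_H :: "real \<Rightarrow> real \<Rightarrow> (real \<Rightarrow> complex) \<Rightarrow> real \<Rightarrow> complex" where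
  "q_dunkl_H \<alpha> q f x = even_part f x + of_real (q powr (2 * \<alpha> + 1)) * odd_part f x"

definition q_dunkl_op :: "real \<Rightarrow> real \<Rightarrow> (real \<Rightarrow> complex) \<Rightarrow> real \<Rightarrow> complex" where
  "q_dunkl_op \<alpha> q f x =
     q_deriv q (q_dunkl_H \<alpha> q f) x
       + of_real (q_number q (2 * \<alpha> + 1)) * ((f x - f (- x)) / of_real (2 * x))"

text \<open>\<open>q_bessel \<alpha> q z\<close> is the normalized third \<open>q\<close>-Bessel function of base \<open>q\<^sup>2\<close>.\<close>

definition q_bessel :: "real \<Rightarrow> real \<Rightarrow> complex \<Rightarrow> complex" where
  "q_bessel \<alpha> q z =
     (\<Sum>n. (- 1) ^ n
        * of_real (q_Gamma (q\<^sup>2) (\<alpha> + 1) * q ^ (n * (n + 1))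
            / (q_Gamma (q\<^sup>2) (\<alpha> + real n + 1) * q_Gamma (q\<^sup>2) (real n + 1)))
        * (z / of_real (1 + q)) ^ (2 * n))"

definition q_dunkl_kernel :: "real \<Rightarrow> real \<Rightarrow> complex \<Rightarrow> real \<Rightarrow> complex" where
  "q_dunkl_kernel \<alpha> q l x =
     q_bessel \<alpha> q (l * of_real x)
       + \<i> * l * of_real x / of_real (q_number q (2 * \<alpha> + 2)) * q_bessel (\<alpha> + 1) q (l * of_real x)"

text \<open>
  The value of \<open>f\<close> at \<open>0\<close> is by convention its limit at \<open>0\<close> along \<open>Rq q\<close>, so the second conjunct
  states both that this limit exists and that it equals \<open>1\<close>.
\<close>

definition q_dunkl_solution :: "real \<Rightarrow> real \<Rightarrow> complex \<Rightarrow> (real \<Rightarrow> complex) \<Rightarrow> bool" where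
  "q_dunkl_solution \<alpha> q l f \<longleftrightarrow>
     (\<forall>x\<in>Rq q. q_dunkl_op \<alpha> q f x = \<i> * l * f x) \<and> (f \<longlongrightarrow> 1) (at 0 within Rq q)"

end

theory Submission
  imports Defs
begin

text \<open>
  Comparing odd and even parts, \<open>\<Lambda> f = i\<lambda>f\<close> is equivalent to the first-order system
  \<open>f\<^sub>e(x/q) - f\<^sub>e(x) = i\<lambda>(1-q)x f\<^sub>o(x)\<close> and
  \<open>f\<^sub>o(x) - Q f\<^sub>o(qx) = i\<lambda>(1-q)x f\<^sub>e(x)\<close> with \<open>Q = q\<^bsup>2\<alpha>+1\<^esup>\<close>.
  The kernel satisfies it by coefficient recurrences of the two power series.
  For uniqueness, the hypothesis \<open>\<alpha> \<ge> -1/2\<close> gives \<open>Q \<le> 1\<close>, so along \<open>x q\<^sup>n\<close> the size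
  of a solution grows, going away from 0, by factors whose infinite product converges; a solution
  with limit 0 at 0 therefore vanishes.
\<close>

section \<open>Infinite q-products, the q-Gamma function and q-numbers\<close>

lemma q_poch_inf_rec:
  fixes a q :: real
  assumes "0 < q" "q < 1" "0 < a" "a < 1"
  shows "q_poch_inf a q = (1 - a) * q_poch_inf (a * q) q" "q_poch_inf a q > 0"
proof -
  have "summable (\<lambda>k. norm ((1 - a * q ^ k) - 1))"
    using assms by (simp add: norm_mult norm_power summable_mult)
  then have conv: "convergent_prod (\<lambda>k. 1 - a * q ^ k)"
    by (intro abs_convergent_prod_imp_convergent_prod summable_imp_abs_convergent_prod)
  have pos: "1 - a * q ^ k > 0" for k
  proof -
    have "q ^ k \<le> 1" using assms by (simp add: power_le_one)
    then have "a * q ^ k \<le> a" using assms by (intro mult_left_le) auto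
    then show ?thesis using assms by linarith
  qed
  then have nz: "1 - a * q ^ k \<noteq> 0" for k by (metis less_irrefl)
  have "(\<Prod>k. 1 - a * q ^ (k + 1)) = (\<Prod>k. 1 - a * q ^ k) / (\<Prod>k<1. 1 - a * q ^ k)"
    by (rule prodinf_divide_initial_segment[OF conv nz])
  then show "q_poch_inf a q = (1 - a) * q_poch_inf (a * q) q"
    using assms by (simp add: q_poch_inf_def mult_ac)
  have "(\<Prod>k. 1 - a * q ^ k) \<ge> 0"
    using less_imp_le[OF pos] convergent_prod_has_prod[OF conv]
    by (meson has_prod_nonneg)
  \<comment> \<open>Convergence of an infinite product excludes the limit 0 unless some factor
    vanishes, so nonnegativity improves to positivity.\<close>
  moreover have "(\<Prod>k. 1 - a * q ^ k) \<noteq> 0"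
    using prodinf_nonzero[OF conv] nz by blast
  ultimately show "q_poch_inf a q > 0" by (simp add: q_poch_inf_def)
qed

text \<open>Passing from \<open>x\<close> to \<open>x + 1\<close> removes the first factor of the
  denominator product, and one power of \<open>1 - p\<close> turns that factor into a q-number.
  Positivity justifies every later cancellation of a Gamma value.\<close>

lemma
  fixes p x :: real
  assumes "0 < p" "p < 1" "0 < x"
  shows q_Gamma_plus1: "q_Gamma p (x + 1) = q_number p x * q_Gamma p x"
    and q_Gamma_pos: "q_Gamma p x > 0"
proof -
  have px: "0 < p powr x" "p powr x < 1"
    using assms powr_less_mono'[of p 0 x] by auto
  note r = q_poch_inf_rec[OF assms(1,2) px]
  note s = q_poch_inf_rec(2)[OF assms(1,2) assms(1,2)]
  show "q_Gamma p x > 0" unfolding q_Gamma_def using r s assms by simp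
  have e: "(1 - p) powr (1 - x) = (1 - p) powr (1 - (x + 1)) * (1 - p)"
    using assms by (simp add: powr_diff powr_minus field_simps)
  have "p powr (x + 1) = p powr x * p" using assms by (simp add: powr_add)
  then show "q_Gamma p (x + 1) = q_number p x * q_Gamma p x"
    unfolding q_Gamma_def q_number_def e r(1) using assms px by simp
qed

lemma q_number_pos:
  assumes "0 < q" "q < 1" "0 < x"
  shows "q_number q x > 0"
  unfolding q_number_def using assms powr_less_mono'[of q 0 x] by simp

text \<open>Bridge between the two bases in play: the operator uses base \<open>q\<close>, the Gamma
  factors of the Bessel series use base \<open>q\<^sup>2\<close>.\<close>

lemma q_number_square_base:
  assumes "0 < q" "q < 1"
  shows "q_number q (2 * x) = (1 + q) * q_number (q\<^sup>2) x"
proof -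
  have "(q\<^sup>2) powr x = q powr (2 * x)"
    using assms powr_powr[of q 2 x] by simp
  moreover have "1 - q\<^sup>2 = (1 - q) * (1 + q)" by (simp add: power2_eq_square algebra_simps)
  ultimately show ?thesis using assms by (simp add: q_number_def)
qed

section \<open>The q-Bessel function as an everywhere convergent power series\<close>

text \<open>The sign and the power of \<open>1 + q\<close> are absorbed into the coefficient, which
  leaves an ordinary power series in the square of the argument.\<close>

definition q_bessel_coeff :: "real \<Rightarrow> real \<Rightarrow> nat \<Rightarrow> real" where
  "q_bessel_coeff \<alpha> q n = (- 1) ^ n * q_Gamma (q\<^sup>2) (\<alpha> + 1) * q ^ (n * (n + 1))
     / (q_Gamma (q\<^sup>2) (\<alpha> + real n + 1) * q_Gamma (q\<^sup>2) (real n + 1)) / (1 + q) ^ (2 * n)"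

lemma q_bessel_altdef:
  "q_bessel \<alpha> q z = (\<Sum>n. of_real (q_bessel_coeff \<alpha> q n) * (z\<^sup>2) ^ n)"
  unfolding q_bessel_def q_bessel_coeff_def
  by (rule arg_cong[where f = suminf])
     (simp add: fun_eq_iff power_divide field_simps flip: power_mult)

context
  fixes q \<alpha> :: real
  assumes q: "0 < q" "q < 1" and \<alpha>: "\<alpha> > -1"
begin

lemma q2: "0 < q\<^sup>2" "q\<^sup>2 < 1"
  using q by (auto simp: power_less_one_iff)

lemma q_bessel_coeff_0 [simp]: "q_bessel_coeff \<alpha> q 0 = 1"
  using q_Gamma_pos[OF q2, of "\<alpha> + 1"] q_Gamma_pos[OF q2, of 1] \<alpha>
    q_poch_inf_rec(2)[OF q2 q2] q2
  by (simp add: q_bessel_coeff_def) (simp add: q_Gamma_def)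

text \<open>Index \<open>n + 1\<close> at order \<alpha> and index \<open>n\<close> at order
  \<alpha> + 1 share the Gamma factor at \<alpha> + n + 2. The other Gamma factors differ by one
  functional equation each, and the exponents (n + 1)(n + 2) and n(n + 1) differ by 2n + 2. This is
  the coefficient form of the backward difference relation.\<close>

lemma q_bessel_coeff_Suc:
  "q_bessel_coeff \<alpha> q (Suc n) * (1 - q ^ (2 * n + 2)) * q_number q (2 * \<alpha> + 2)
     = - (1 - q) * q ^ (2 * n + 2) * q_bessel_coeff (\<alpha> + 1) q n"
proof -
  let ?G = "q_Gamma (q\<^sup>2)" and ?N = "q_number (q\<^sup>2)"
  have g: "?G (\<alpha> + 2) = ?N (\<alpha> + 1) * ?G (\<alpha> + 1)"
    using q_Gamma_plus1[OF q2, of "\<alpha> + 1"] \<alpha> by (simp add: add_ac)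
  have h: "?G (real n + 2) = ?N (real n + 1) * ?G (real n + 1)"
    using q_Gamma_plus1[OF q2, of "real n + 1"] by (simp add: add_ac)
  have pos: "?G (real n + 1) > 0" "?G (\<alpha> + real n + 2) > 0" "?G (\<alpha> + 1) > 0"
      "?N (\<alpha> + 1) > 0" "?N (real n + 1) > 0"
    using \<alpha> by (auto intro!: q_Gamma_pos q_number_pos q2)
  have nn: "1 - q ^ (2 * n + 2) = ?N (real n + 1) * ((1 - q) * (1 + q))"
  proof -
    have "(q\<^sup>2) powr (real n + 1) = q ^ (2 * n + 2)"
      using q by (simp add: powr_add powr_realpow power_add power_mult power2_eq_square)
    moreover have "(1 - q) * (1 + q) = 1 - q\<^sup>2" by (simp add: power2_eq_square algebra_simps)
    ultimately show ?thesis using q2 by (simp add: q_number_def)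
  qed
  have na: "q_number q (2 * \<alpha> + 2) = (1 + q) * ?N (\<alpha> + 1)"
    using q_number_square_base[OF q, of "\<alpha> + 1"] by simp
  have e: "q ^ (Suc n * (Suc n + 1)) = q ^ (n * (n + 1)) * q ^ (2 * n + 2)"
    unfolding power_add[symmetric] by (rule arg_cong[where f = "power q"]) simp
  have c1: "q_bessel_coeff \<alpha> q (Suc n) = - ((- 1) ^ n) * ?G (\<alpha> + 1) * (q ^ (n * (n + 1)) * q ^ (2 * n + 2))
     / (?G (\<alpha> + real n + 2) * (?N (real n + 1) * ?G (real n + 1))) / ((1 + q) ^ (2 * n) * (1 + q)\<^sup>2)"
    unfolding q_bessel_coeff_def e
    using h by (simp add: add_ac power2_eq_square)
  have c2: "q_bessel_coeff (\<alpha> + 1) q n = (- 1) ^ n * (?N (\<alpha> + 1) * ?G (\<alpha> + 1)) * q ^ (n * (n + 1))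
     / (?G (\<alpha> + real n + 2) * ?G (real n + 1)) / (1 + q) ^ (2 * n)"
    unfolding q_bessel_coeff_def using g by (simp add: add_ac)
  \<comment> \<open>The cancellation is carried out on generic reals; \<open>d\<close> stands for
    \<open>1 - q\<close> and \<open>b\<close> for the q-number of \<open>n + 1\<close>.\<close>
  have alg: "- s * g * (e * t) / (h * (b * k)) / (r * (1 + q)\<^sup>2) * (b * (d * (1 + q))) * ((1 + q) * a)
     = - d * t * (s * (a * g) * e / (h * k) / r)"
    if "b \<noteq> 0" for s g e t h b k r a d :: real
    using that q by (simp add: power2_eq_square mult_ac)
  show ?thesis unfolding c1 c2 nn na using pos by (intro alg) auto
qed

text \<open>At a fixed index, raising the order changes only two Gamma factors. The one depending on
  \<open>n\<close> produces the q-number of \<alpha> + n + 1, which the bracket on the left cancels.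
  This is the coefficient form of the forward difference relation.\<close>

lemma q_bessel_coeff_shift:
  "q_bessel_coeff (\<alpha> + 1) q n * (1 - q powr (2 * \<alpha> + 2) * q ^ (2 * n))
     = (1 - q) * q_number q (2 * \<alpha> + 2) * q_bessel_coeff \<alpha> q n"
proof -
  let ?G = "q_Gamma (q\<^sup>2)" and ?N = "q_number (q\<^sup>2)"
  have g: "?G (\<alpha> + 2) = ?N (\<alpha> + 1) * ?G (\<alpha> + 1)"
    using q_Gamma_plus1[OF q2, of "\<alpha> + 1"] \<alpha> by (simp add: add_ac)
  have h: "?G (\<alpha> + real n + 2) = ?N (\<alpha> + real n + 1) * ?G (\<alpha> + real n + 1)"
    using q_Gamma_plus1[OF q2, of "\<alpha> + real n + 1"] \<alpha> by (simp add: add_ac)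
  have pos: "?G (real n + 1) > 0" "?G (\<alpha> + real n + 1) > 0" "?G (\<alpha> + 1) > 0"
      "?N (\<alpha> + 1) > 0" "?N (\<alpha> + real n + 1) > 0"
    using \<alpha> by (auto intro!: q_Gamma_pos q_number_pos q2)
  have nn: "1 - q powr (2 * \<alpha> + 2) * q ^ (2 * n) = (1 - q) * ((1 + q) * ?N (\<alpha> + real n + 1))"
  proof -
    have "q powr (2 * \<alpha> + 2) * q ^ (2 * n) = q powr (2 * (\<alpha> + real n + 1))"
    proof -
      have "q ^ (2 * n) = q powr (2 * real n)"
        using q powr_realpow[of q "2 * n"] by simp
      moreover have "2 * (\<alpha> + real n + 1) = 2 * \<alpha> + 2 + 2 * real n" by simp
      ultimately show ?thesis by (simp only: powr_add)
    qed
    then show ?thesis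
      using q unfolding q_number_square_base[OF q, of "\<alpha> + real n + 1", symmetric]
      by (simp add: q_number_def)
  qed
  have na: "q_number q (2 * \<alpha> + 2) = (1 + q) * ?N (\<alpha> + 1)"
    using q_number_square_base[OF q, of "\<alpha> + 1"] by simp
  have c2: "q_bessel_coeff (\<alpha> + 1) q n = (- 1) ^ n * (?N (\<alpha> + 1) * ?G (\<alpha> + 1)) * q ^ (n * (n + 1))
     / (?N (\<alpha> + real n + 1) * ?G (\<alpha> + real n + 1) * ?G (real n + 1)) / (1 + q) ^ (2 * n)"
    unfolding q_bessel_coeff_def using g h by (simp add: add_ac)
  have alg: "s * (a * g) * e / (b * h * k) / r * ((1 - q) * ((1 + q) * b))
     = (1 - q) * ((1 + q) * a) * (s * g * e / (h * k) / r)"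
    if "b \<noteq> 0" for s g e h b k r a :: real
    using that by (simp add: mult_ac)
  show ?thesis unfolding c2 nn na unfolding q_bessel_coeff_def using pos by (intro alg) auto
qed

text \<open>Combining the two coefficient relations bounds the ratio of consecutive coefficients by
  a constant times \<open>q ^ (2 * n)\<close>, so the radius of convergence is infinite.\<close>

lemma summable_q_bessel:
  fixes w :: complex
  shows "summable (\<lambda>n. of_real (q_bessel_coeff \<alpha> q n) * w ^ n)"
proof -
  let ?c = "q_bessel_coeff \<alpha> q"
  \<comment> \<open>The value at \<open>n = 0\<close> of the product \<open>u * v\<close> below;
    both factors increase with \<open>n\<close>, so \<open>B\<close> is a uniform lower
    bound.\<close>
  define B where "B = (1 - q\<^sup>2) * (1 - q powr (2 * \<alpha> + 2))"
  have pa: "0 < q powr (2 * \<alpha> + 2)" "q powr (2 * \<alpha> + 2) < 1"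
    using q \<alpha> powr_less_mono'[of q 0 "2 * \<alpha> + 2"] by auto
  then have B: "B > 0" using q2 by (simp add: B_def)
  have ratio: "\<bar>?c (Suc n)\<bar> * B \<le> q ^ (2 * n) * \<bar>?c n\<bar>" for n
  proof -
    define u where "u = 1 - q ^ (2 * n + 2)"
    define v where "v = 1 - q powr (2 * \<alpha> + 2) * q ^ (2 * n)"
    define N where "N = q_number q (2 * \<alpha> + 2)"
    have N: "N > 0" unfolding N_def using q_number_pos[OF q] \<alpha> by simp
    have qn: "q ^ (2 * n) \<le> 1" "q ^ (2 * n) > 0" using q by (auto simp: power_le_one)
    have u: "u \<ge> 1 - q\<^sup>2" using mult_right_mono[OF qn(1), of "q\<^sup>2"] unfolding u_def power_add by simp
    have v: "v \<ge> 1 - q powr (2 * \<alpha> + 2)" using qn pa unfolding v_def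
      by (simp add: mult_left_le)
    \<comment> \<open>Going up in order by one relation and back down by the other eliminates order
      \<alpha> + 1; the common factor \<open>N\<close> then cancels.\<close>
    have "N * (?c (Suc n) * u * v) = (?c (Suc n) * u * N) * v" by simp
    also have "\<dots> = - (1 - q) * q ^ (2 * n + 2) * (q_bessel_coeff (\<alpha> + 1) q n * v)"
      using q_bessel_coeff_Suc[of n] by (simp add: u_def N_def)
    also have "\<dots> = N * (- ((1 - q)\<^sup>2 * q ^ (2 * n + 2) * ?c n))"
    proof -
      have "- d * y * (d * N * c) = N * (- (d\<^sup>2 * y * c))" for d y c
        by (simp add: power2_eq_square)
      then show ?thesis unfolding v_def q_bessel_coeff_shift N_def .
    qed
    finally have e: "?c (Suc n) * u * v = - ((1 - q)\<^sup>2 * q ^ (2 * n + 2) * ?c n)"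
      using N mult_left_cancel[of N] by blast
    have "\<bar>?c (Suc n)\<bar> * B \<le> \<bar>?c (Suc n)\<bar> * (u * v)"
      unfolding B_def using u v pa q2 by (intro mult_left_mono mult_mono) auto
    also have "\<dots> = \<bar>?c (Suc n) * u * v\<bar>"
      using u v pa q2 by (simp add: abs_mult)
    also have "\<dots> = ((1 - q)\<^sup>2 * q\<^sup>2) * (q ^ (2 * n) * \<bar>?c n\<bar>)"
    proof -
      have "q ^ (2 * n + 2) = q\<^sup>2 * q ^ (2 * n)" by (simp only: power_add mult.commute)
      then show ?thesis unfolding e using q by (simp only: abs_minus_cancel abs_mult abs_power2 power_even_abs) simp
    qed
    also have "\<dots> \<le> 1 * (q ^ (2 * n) * \<bar>?c n\<bar>)"
      using q by (intro mult_right_mono mult_le_one) (auto simp: power_le_one)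
    finally show ?thesis by simp
  qed
  have "(\<lambda>n. (q\<^sup>2) ^ n * (norm w / B)) \<longlonglongrightarrow> 0"
    using q2 by (intro tendsto_mult_left_zero LIMSEQ_power_zero) auto
  then have "\<forall>\<^sub>F n in sequentially. (q\<^sup>2) ^ n * (norm w / B) < 1 / 2"
    by (rule order_tendstoD) simp
  then obtain M where M: "\<And>n. n \<ge> M \<Longrightarrow> (q\<^sup>2) ^ n * (norm w / B) < 1 / 2"
    unfolding eventually_sequentially by blast
  show ?thesis
  proof (rule summable_ratio_test[where c = "1 / 2" and N = M])
    fix n assume "n \<ge> M"
    have "\<bar>?c (Suc n)\<bar> \<le> (q\<^sup>2) ^ n * \<bar>?c n\<bar> / B"
      using ratio[of n, unfolded power_mult] B by (simp add: pos_le_divide_eq)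
    then have "norm (of_real (?c (Suc n)) * w ^ Suc n) \<le> (q\<^sup>2) ^ n * \<bar>?c n\<bar> / B * norm w ^ Suc n"
      unfolding norm_mult norm_power norm_of_real by (rule mult_right_mono) simp
    also have "\<dots> = ((q\<^sup>2) ^ n * (norm w / B)) * norm (of_real (?c n) * w ^ n)"
      by (simp add: norm_mult norm_power)
    also have "\<dots> \<le> 1 / 2 * norm (of_real (?c n) * w ^ n)"
      by (intro mult_right_mono less_imp_le[OF M] \<open>n \<ge> M\<close>) auto
    finally show "norm (of_real (?c (Suc n)) * w ^ Suc n) \<le> 1 / 2 * norm (of_real (?c n) * w ^ n)" .
  qed simp
qed

lemma q_bessel_sums:
  "(\<lambda>n. of_real (q_bessel_coeff \<alpha> q n) * (z\<^sup>2) ^ n) sums q_bessel \<alpha> q z"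
  unfolding q_bessel_altdef by (rule summable_sums[OF summable_q_bessel])

lemma q_bessel_0 [simp]: "q_bessel \<alpha> q 0 = 1"
  unfolding q_bessel_altdef by (simp add: powser_zero)

lemma continuous_q_bessel [continuous_intros]: "isCont (q_bessel \<alpha> q) z"
proof -
  have "isCont (\<lambda>w::complex. \<Sum>n. of_real (q_bessel_coeff \<alpha> q n) * w ^ n) (z\<^sup>2)"
    by (rule isCont_powser_converges_everywhere[OF summable_q_bessel])
  then show ?thesis unfolding q_bessel_altdef[abs_def]
    by (rule isCont_o2[where f = "\<lambda>z. z\<^sup>2", rotated]) simp
qed

end

section \<open>First-order q-difference relations between consecutive orders\<close>

text \<open>The constant terms cancel in the difference. After an index shift the remaining terms
  are those of order \<alpha> + 1, by \<open>q_bessel_coeff_Suc\<close>.\<close>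

lemma q_bessel_diff_backward:
  assumes q: "0 < q" "q < 1" and \<alpha>: "\<alpha> > -1"
  shows "q_bessel \<alpha> q (z / of_real q) - q_bessel \<alpha> q z
    = - of_real ((1 - q) / q_number q (2 * \<alpha> + 2)) * z\<^sup>2 * q_bessel (\<alpha> + 1) q z"
proof -
  let ?c = "\<lambda>n. complex_of_real (q_bessel_coeff \<alpha> q n)"
  define N where "N = q_number q (2 * \<alpha> + 2)"
  have N: "N > 0" unfolding N_def using q_number_pos[OF q] \<alpha> by simp
  define t where "t n = ?c n * ((z / of_real q)\<^sup>2) ^ n - ?c n * (z\<^sup>2) ^ n" for n
  have t: "t sums (q_bessel \<alpha> q (z / of_real q) - q_bessel \<alpha> q z)"
    unfolding t_def by (intro sums_diff q_bessel_sums[OF assms])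
  have "t (Suc n) = - of_real ((1 - q) / N) * z\<^sup>2 * (of_real (q_bessel_coeff (\<alpha> + 1) q n) * (z\<^sup>2) ^ n)" for n
  proof -
    have N_eq: "x / (N * y) = - ((1 - q) / N) * c" if "x = - (1 - q) * y * c" "y \<noteq> 0" for x y c
      using that N by (simp add: field_simps)
    \<comment> \<open>Expanding the fraction by \<open>N\<close> makes its numerator the left side
      of \<open>q_bessel_coeff_Suc\<close>.\<close>
    have "t (Suc n) = of_real (q_bessel_coeff \<alpha> q (Suc n) * (1 - q ^ (2 * n + 2)) * N
        / (N * q ^ (2 * n + 2))) * (z\<^sup>2) ^ Suc n"
    proof -
      have "((z / of_real q)\<^sup>2) ^ Suc n = (z\<^sup>2) ^ Suc n / of_real (q ^ (2 * n + 2))"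
        by (simp add: power_divide power_mult) (simp add: power_mult power2_eq_square)
      moreover have "of_real b * (w / of_real x) - of_real b * w = of_real (b * (1 - x) * N / (N * x)) * w"
        if "x \<noteq> 0" for w :: complex and b x
        using that N by (simp add: field_simps)
      moreover have "q ^ (2 * n + 2) \<noteq> 0" using q by simp
      ultimately show ?thesis unfolding t_def by (simp only:)
    qed
    also have "\<dots> = of_real (- ((1 - q) / N) * q_bessel_coeff (\<alpha> + 1) q n) * (z\<^sup>2) ^ Suc n"
      using q by (subst N_eq[OF q_bessel_coeff_Suc[OF assms, folded N_def]]) simp_all
    finally show ?thesis by (simp only: power_Suc of_real_mult of_real_minus mult_ac)
  qed
  moreover have "(\<lambda>n. - of_real ((1 - q) / N) * z\<^sup>2 * (of_real (q_bessel_coeff (\<alpha> + 1) q n) * (z\<^sup>2) ^ n))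
      sums (- of_real ((1 - q) / N) * z\<^sup>2 * q_bessel (\<alpha> + 1) q z)"
    using \<alpha> by (intro sums_mult q_bessel_sums[OF q]) auto
  ultimately have "(\<lambda>n. t (Suc n)) sums (- of_real ((1 - q) / N) * z\<^sup>2 * q_bessel (\<alpha> + 1) q z)"
    by simp
  then have "t sums (- of_real ((1 - q) / N) * z\<^sup>2 * q_bessel (\<alpha> + 1) q z + t 0)"
    by (rule sums_Suc)
  moreover have "t 0 = 0" by (simp add: t_def)
  ultimately show ?thesis using sums_unique2[OF t] unfolding N_def by simp
qed

text \<open>Termwise, the difference multiplies the n-th coefficient of order \<alpha> + 1 by the
  bracket in \<open>q_bessel_coeff_shift\<close>.\<close>

lemma q_bessel_diff_forward:
  assumes q: "0 < q" "q < 1" and \<alpha>: "\<alpha> > -1"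
  shows "q_bessel (\<alpha> + 1) q z - of_real (q powr (2 * \<alpha> + 2)) * q_bessel (\<alpha> + 1) q (of_real q * z)
    = of_real ((1 - q) * q_number q (2 * \<alpha> + 2)) * q_bessel \<alpha> q z"
proof -
  let ?c = "\<lambda>n. complex_of_real (q_bessel_coeff (\<alpha> + 1) q n)"
  have a: "\<alpha> + 1 > -1" using \<alpha> by simp
  have "(\<lambda>n. ?c n * (z\<^sup>2) ^ n - of_real (q powr (2 * \<alpha> + 2)) * (?c n * ((of_real q * z)\<^sup>2) ^ n))
    sums (q_bessel (\<alpha> + 1) q z - of_real (q powr (2 * \<alpha> + 2)) * q_bessel (\<alpha> + 1) q (of_real q * z))"
    by (intro sums_diff sums_mult q_bessel_sums[OF q a])
  moreover have "?c n * (z\<^sup>2) ^ n - of_real (q powr (2 * \<alpha> + 2)) * (?c n * ((of_real q * z)\<^sup>2) ^ n)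
    = of_real ((1 - q) * q_number q (2 * \<alpha> + 2)) * (of_real (q_bessel_coeff \<alpha> q n) * (z\<^sup>2) ^ n)" for n
  proof -
    have "?c n * (z\<^sup>2) ^ n - of_real (q powr (2 * \<alpha> + 2)) * (?c n * ((of_real q * z)\<^sup>2) ^ n)
      = of_real (q_bessel_coeff (\<alpha> + 1) q n * (1 - q powr (2 * \<alpha> + 2) * q ^ (2 * n))) * (z\<^sup>2) ^ n"
    proof -
      have "((of_real q * z)\<^sup>2) ^ n = of_real (q ^ (2 * n)) * (z\<^sup>2) ^ n"
        by (simp add: power_mult_distrib power_mult)
      moreover have "of_real b * w - of_real P * (of_real b * (of_real y * w)) = of_real (b * (1 - P * y)) * w"
        for w :: complex and b P y
        by (simp add: algebra_simps)
      ultimately show ?thesis by (simp only:)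
    qed
    then show ?thesis unfolding q_bessel_coeff_shift[OF assms] by simp
  qed
  moreover have "(\<lambda>n. of_real ((1 - q) * q_number q (2 * \<alpha> + 2)) * (of_real (q_bessel_coeff \<alpha> q n) * (z\<^sup>2) ^ n))
    sums (of_real ((1 - q) * q_number q (2 * \<alpha> + 2)) * q_bessel \<alpha> q z)"
    by (intro sums_mult q_bessel_sums[OF assms])
  ultimately show ?thesis by (simp add: sums_unique2)
qed

section \<open>Splitting the eigenvalue equation by parity\<close>

lemma even_part_minus [simp]: "even_part f (- x) = even_part f x"
  by (simp add: even_part_def add.commute)

lemma odd_part_minus [simp]: "odd_part f (- x) = - odd_part f x"
  by (simp add: odd_part_def field_simps)

lemma even_plus_odd_part: "f x = even_part f x + odd_part f x"
  by (simp add: even_part_def odd_part_def field_simps)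

text \<open>The q-derivative acts as a backward difference on even functions and as a forward
  difference on odd ones. The reflection term contributes \<open>1 - Q\<close> times the odd part,
  which removes the weight \<open>Q\<close> at \<open>x\<close> but not at
  \<open>q * x\<close>.\<close>

lemma q_dunkl_op_altdef:
  assumes "q \<noteq> 1" "x \<noteq> 0"
  shows "q_dunkl_op \<alpha> q f x =
    (even_part f (x / q) - even_part f x + odd_part f x
       - of_real (q powr (2 * \<alpha> + 1)) * odd_part f (q * x)) / of_real ((1 - q) * x)"
proof -
  define Q where "Q = complex_of_real (q powr (2 * \<alpha> + 1))"
  have "f x - f (- x) = 2 * odd_part f x" by (simp add: odd_part_def)
  then have 1: "of_real (q_number q (2 * \<alpha> + 1)) * ((f x - f (- x)) / of_real (2 * x))
      = (1 - Q) * odd_part f x / of_real ((1 - q) * x)"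
    using assms by (simp add: q_number_def Q_def field_simps)
  have xq: "inverse q * x = x / q" by (simp add: field_simps)
  have 2: "q_deriv q (q_dunkl_H \<alpha> q f) x
     = (even_part f (x / q) - even_part f x + Q * odd_part f x - Q * odd_part f (q * x)) / of_real ((1 - q) * x)"
    unfolding q_deriv_def q_dunkl_H_def Q_def[symmetric] xq
    using assms by (simp add: divide_simps) (simp add: algebra_simps)
  show ?thesis unfolding q_dunkl_op_def 1 2 Q_def[symmetric]
    by (simp add: add_divide_distrib[symmetric] algebra_simps)
qed

lemma Rq_nonzero: "0 < q \<Longrightarrow> x \<in> Rq q \<Longrightarrow> x \<noteq> 0"
  by (auto simp: Rq_def)

lemma Rq_minus: "x \<in> Rq q \<Longrightarrow> - x \<in> Rq q"
  unfolding Rq_def by force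

lemma Rq_mult_powi:
  assumes "0 < q" "x \<in> Rq q"
  shows "q powi k * x \<in> Rq q"
proof -
  obtain n where n: "x = q powi n \<or> x = - (q powi n)" using assms by (auto simp: Rq_def)
  have "q powi k * q powi n = q powi (k + n)" using assms by (simp add: power_int_add)
  then show ?thesis unfolding Rq_def using n by (auto intro!: exI[of _ "k + n"])
qed

text \<open>Cleared of its denominator, the equation is the sum of an identity between even
  functions of \<open>x\<close> and one between odd functions. Since \<open>Rq q\<close> is
  symmetric, evaluating at \<open>x\<close> and at \<open>- x\<close> separates the two.\<close>

lemma q_dunkl_eigen_iff:
  assumes q: "0 < q" "q < 1"
  shows "(\<forall>x\<in>Rq q. q_dunkl_op \<alpha> q f x = \<i> * l * f x) \<longleftrightarrow>
    (\<forall>x\<in>Rq q. even_part f (x / q) - even_part f x = \<i> * l * of_real ((1 - q) * x) * odd_part f x \<and>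
      odd_part f x - of_real (q powr (2 * \<alpha> + 1)) * odd_part f (q * x)
        = \<i> * l * of_real ((1 - q) * x) * even_part f x)"
    (is "_ \<longleftrightarrow> (\<forall>x\<in>_. ?U x = ?A x \<and> ?V x = ?B x)")
proof -
  have iff: "q_dunkl_op \<alpha> q f x = \<i> * l * f x \<longleftrightarrow> ?U x + ?V x = ?A x + ?B x" if "x \<in> Rq q" for x
  proof -
    have nz: "complex_of_real ((1 - q) * x) \<noteq> 0" using Rq_nonzero[OF q(1) that] q by simp
    have sum: "?U x + ?V x = even_part f (x / q) - even_part f x + odd_part f x
        - of_real (q powr (2 * \<alpha> + 1)) * odd_part f (q * x)" by simp
    have "?A x + ?B x = \<i> * l * f x * of_real ((1 - q) * x)"
      unfolding even_plus_odd_part[of f x] by (simp add: algebra_simps)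
    then show ?thesis
      unfolding sum q_dunkl_op_altdef[OF less_imp_neq[OF q(2)] Rq_nonzero[OF q(1) that]]
        nonzero_divide_eq_eq[OF nz] by simp
  qed
  have parity: "?U (- x) = ?U x" "?V (- x) = - ?V x" "?A (- x) = ?A x" "?B (- x) = - ?B x" for x
    using even_part_minus[of f "x / q"] odd_part_minus[of f "q * x"]
    by (simp_all del: even_part_minus odd_part_minus add: even_part_minus[of f x] odd_part_minus[of f x])
  have lin: "u = a \<and> v = b" if "u + v = a + b" "u - v = a - b" for u v a b :: complex
  proof -
    have "2 * u = (u + v) + (u - v)" by simp
    also have "\<dots> = 2 * a" unfolding that by simp
    finally show ?thesis using that by simp
  qed
  show ?thesis
  proof (intro iffI ballI)
    fix x assume H: "\<forall>x\<in>Rq q. q_dunkl_op \<alpha> q f x = \<i> * l * f x" and x: "x \<in> Rq q"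
    have "?U x + ?V x = ?A x + ?B x" using H iff x by blast
    moreover have "?U (- x) + ?V (- x) = ?A (- x) + ?B (- x)" using H iff Rq_minus[OF x] by blast
    then have "?U x - ?V x = ?A x - ?B x" unfolding parity by (simp only: diff_conv_add_uminus)
    ultimately show "?U x = ?A x \<and> ?V x = ?B x" by (rule lin)
  next
    fix x assume "\<forall>x\<in>Rq q. ?U x = ?A x \<and> ?V x = ?B x" and "x \<in> Rq q"
    then show "q_dunkl_op \<alpha> q f x = \<i> * l * f x" using iff by simp
  qed
qed

section \<open>The kernel is a solution\<close>

lemma q_bessel_minus [simp]: "q_bessel \<alpha> q (- z) = q_bessel \<alpha> q z"
  by (simp add: q_bessel_altdef)

lemma even_part_q_dunkl_kernel:
  "even_part (q_dunkl_kernel \<alpha> q l) x = q_bessel \<alpha> q (l * of_real x)"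
  by (simp add: even_part_def q_dunkl_kernel_def)

lemma odd_part_q_dunkl_kernel:
  "odd_part (q_dunkl_kernel \<alpha> q l) x =
    \<i> * l * of_real x / of_real (q_number q (2 * \<alpha> + 2)) * q_bessel (\<alpha> + 1) q (l * of_real x)"
  by (simp add: odd_part_def q_dunkl_kernel_def)

text \<open>The two Bessel terms are the even and odd parts of the kernel, so the system is the pair
  of relations between orders \<alpha> and \<alpha> + 1. The value at 0 comes from continuity on the
  whole line.\<close>

lemma q_dunkl_kernel_solution:
  assumes q: "0 < q" "q < 1" and \<alpha>: "\<alpha> > -1"
  shows "q_dunkl_solution \<alpha> q l (q_dunkl_kernel \<alpha> q l)"
  unfolding q_dunkl_solution_def q_dunkl_eigen_iff[OF q]
proof (intro conjI ballI)
  define N where "N = q_number q (2 * \<alpha> + 2)"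
  have N: "N > 0" unfolding N_def using q_number_pos[OF q] \<alpha> by simp
  fix x :: real
  let ?z = "l * of_real x"
  show "even_part (q_dunkl_kernel \<alpha> q l) (x / q) - even_part (q_dunkl_kernel \<alpha> q l) x
      = \<i> * l * of_real ((1 - q) * x) * odd_part (q_dunkl_kernel \<alpha> q l) x"
    using q_bessel_diff_backward[OF assms, of ?z] N q
    unfolding even_part_q_dunkl_kernel odd_part_q_dunkl_kernel N_def[symmetric]
    by (simp add: power2_eq_square field_simps)
  \<comment> \<open>The odd part carries a factor \<open>x\<close>, so its value at
    \<open>q * x\<close> brings one more \<open>q\<close>, which raises the exponent to the one in
    the forward relation.\<close>
  have Q: "q powr (2 * \<alpha> + 2) = q * q powr (2 * \<alpha> + 1)"
    using q powr_add[of q 1 "2 * \<alpha> + 1"] by (simp add: add_ac)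
  have "odd_part (q_dunkl_kernel \<alpha> q l) x
      - of_real (q powr (2 * \<alpha> + 1)) * odd_part (q_dunkl_kernel \<alpha> q l) (q * x)
      = \<i> * ?z / of_real N * (q_bessel (\<alpha> + 1) q ?z
         - of_real (q powr (2 * \<alpha> + 2)) * q_bessel (\<alpha> + 1) q (of_real q * ?z))"
    unfolding odd_part_q_dunkl_kernel N_def[symmetric] Q by (simp add: algebra_simps)
  also have "\<dots> = \<i> * l * of_real ((1 - q) * x) * even_part (q_dunkl_kernel \<alpha> q l) x"
    unfolding q_bessel_diff_forward[OF assms] even_part_q_dunkl_kernel N_def[symmetric]
    using N by simp
  finally show "odd_part (q_dunkl_kernel \<alpha> q l) x
      - of_real (q powr (2 * \<alpha> + 1)) * odd_part (q_dunkl_kernel \<alpha> q l) (q * x)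
      = \<i> * l * of_real ((1 - q) * x) * even_part (q_dunkl_kernel \<alpha> q l) x" .
next
  have a: "\<alpha> + 1 > -1" using \<alpha> by simp
  have "isCont (q_dunkl_kernel \<alpha> q l) 0"
    unfolding q_dunkl_kernel_def[abs_def]
    by (intro continuous_intros isCont_o2[OF _ continuous_q_bessel[OF assms]]
        isCont_o2[OF _ continuous_q_bessel[OF q a]]) (use q_number_pos[OF q, of "2 * \<alpha> + 2"] \<alpha> in auto)
  moreover have "q_dunkl_kernel \<alpha> q l 0 = 1"
    using q_bessel_0[OF assms] by (simp add: q_dunkl_kernel_def)
  ultimately have "q_dunkl_kernel \<alpha> q l \<midarrow>0\<rightarrow> 1" by (simp add: isCont_def)
  then show "(q_dunkl_kernel \<alpha> q l \<longlongrightarrow> 1) (at 0 within Rq q)"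
    by (rule tendsto_mono[rotated]) (simp add: at_le)
qed

section \<open>Uniqueness through decay along geometric sequences\<close>

text \<open>
  With \<open>S n = \<bar>E n\<bar> + \<bar>D (n + 1)\<bar>\<close>, the system gives
  \<open>S n \<le> (1 + O(q\<^sup>n)) S (n + 1)\<close>; since \<open>\<Sum>q\<^sup>n\<close> converges,
  multiplying by the telescoping weight \<open>exp (- C q\<^sup>n\<^sup>+\<^sup>1)\<close> makes \<open>S\<close> nondecreasing,
  while it tends to 0.
\<close>

lemma backward_q_system_zero:
  fixes E D :: "nat \<Rightarrow> complex" and m :: complex
  assumes q: "0 < q" "q < 1" and Q: "norm Q \<le> 1"
    and E: "\<And>n. E n = E (Suc n) + m * of_real q ^ Suc n * D (Suc n)"
    and D: "\<And>n. D n = Q * D (Suc n) + m * of_real q ^ n * E n"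
    and lim: "E \<longlonglongrightarrow> 0" "D \<longlonglongrightarrow> 0"
  shows "E n = 0" "D n = 0"
proof -
  define M where "M = norm m"
  \<comment> \<open>Chosen so that \<open>C * q ^ Suc n - C * q ^ Suc (Suc n)\<close> equals
    \<open>(M + M\<^sup>2) * q ^ Suc n\<close>, the bound for \<open>e + e\<^sup>2\<close>
    below.\<close>
  define C where "C = (M + M\<^sup>2) / (1 - q)"
  \<comment> \<open>The index of \<open>D\<close> is one ahead because \<open>E n\<close> is
    computed from \<open>D (Suc n)\<close>; thus \<open>S n\<close> is controlled by
    \<open>S (Suc n)\<close> alone.\<close>
  define S where "S n = norm (E n) + norm (D (Suc n))" for n
  define T where "T n = S n * exp (- C * q ^ Suc n)" for n
  have step: "S n \<le> exp (C * q ^ Suc n - C * q ^ Suc (Suc n)) * S (Suc n)" for n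
  proof -
    define e where "e = M * q ^ Suc n"
    have e: "e \<ge> 0" using q by (simp add: e_def M_def)
    let ?E = "norm (E (Suc n))" and ?D = "norm (D (Suc (Suc n)))"
    have ne: "norm (m * of_real q ^ Suc n) = e"
      using q by (simp add: e_def M_def norm_mult norm_power)
    have "norm (D (Suc n)) \<le> norm Q * ?D + e * ?E"
      unfolding D[of "Suc n"] using norm_triangle_ineq[of "Q * D (Suc (Suc n))" "m * of_real q ^ Suc n * E (Suc n)"]
      by (simp only: norm_mult[of Q] norm_mult[of "m * of_real q ^ Suc n"] ne)
    also have "\<dots> \<le> ?D + e * ?E" using Q by (simp add: mult_left_le_one_le)
    finally have d: "norm (D (Suc n)) \<le> ?D + e * ?E" .
    have "norm (E n) \<le> ?E + e * norm (D (Suc n))"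
      unfolding E[of n] using norm_triangle_ineq[of "E (Suc n)" "m * of_real q ^ Suc n * D (Suc n)"]
      by (simp only: norm_mult[of "m * of_real q ^ Suc n"] ne)
    also have "\<dots> \<le> ?E + e * (?D + e * ?E)" using d e by (simp add: mult_left_mono)
    finally have "S n \<le> ?E + e * (?D + e * ?E) + (?D + e * ?E)" using d by (simp add: S_def)
    also have "\<dots> \<le> (1 + (e + e\<^sup>2)) * S (Suc n)"
      using e by (simp add: S_def algebra_simps power2_eq_square)
    also have "\<dots> \<le> exp (C * q ^ Suc n - C * q ^ Suc (Suc n)) * S (Suc n)"
    proof (rule mult_right_mono)
      have "(q ^ Suc n)\<^sup>2 \<le> q ^ Suc n"
        unfolding power2_eq_square using q by (intro mult_left_le) (auto simp: power_le_one mult_le_one)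
      then have "e + e\<^sup>2 \<le> (M + M\<^sup>2) * q ^ Suc n"
        unfolding e_def power_mult_distrib distrib_right by (intro add_left_mono mult_left_mono) auto
      also have "\<dots> = C * q ^ Suc n - C * q ^ Suc (Suc n)"
      proof -
        have "M + M\<^sup>2 = C * (1 - q)" using q by (simp add: C_def)
        then show ?thesis by (simp only: power_Suc[of q "Suc n"] left_diff_distrib right_diff_distrib mult_1_right mult.assoc)
      qed
      finally show "1 + (e + e\<^sup>2) \<le> exp (C * q ^ Suc n - C * q ^ Suc (Suc n))"
        using exp_ge_add_one_self order_trans by (meson add_left_mono)
    qed (simp add: S_def)
    finally show ?thesis .
  qed
  have "incseq T"
  proof (rule incseq_SucI)
    fix n
    have "T n \<le> exp (C * q ^ Suc n - C * q ^ Suc (Suc n)) * S (Suc n) * exp (- C * q ^ Suc n)"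
      unfolding T_def by (rule mult_right_mono[OF step]) simp
    also have "\<dots> = T (Suc n)"
      unfolding T_def by (simp add: mult.assoc mult.left_commute[of _ "S _"] flip: exp_add del: power_Suc)
    finally show "T n \<le> T (Suc n)" .
  qed
  moreover have "T \<longlonglongrightarrow> (0 + 0) * exp (- C * 0)"
    unfolding T_def S_def using q lim
    by (intro tendsto_intros LIMSEQ_Suc tendsto_norm_zero LIMSEQ_power_zero) auto
  \<comment> \<open>A nondecreasing sequence stays below its limit, here 0.\<close>
  ultimately have "T n \<le> 0" for n using incseq_le[of T 0 n] by simp
  then have "S n \<le> 0" for n unfolding T_def by (simp add: mult_le_0_iff)
  moreover have "S n \<ge> 0" for n by (simp add: S_def)
  ultimately have S: "S n = 0" for n by (meson order_antisym)
  then have "norm (E n) = 0" "norm (D (Suc n)) = 0" for n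
    using S[of n] unfolding S_def by (smt (verit) norm_ge_zero)+
  then have z: "E n = 0" "D (Suc n) = 0" for n by auto
  \<comment> \<open>\<open>S\<close> sees \<open>D\<close> only from index 1 on; the recursion for
    \<open>D\<close> recovers index 0.\<close>
  then show "E n = 0" "D n = 0" using D[of n] by simp_all
qed

text \<open>Sampling the even and odd parts at \<open>q ^ n * x\<close> turns the system into the
  recursion of \<open>backward_q_system_zero\<close>; index 0 is the point \<open>x\<close> itself.
  The bound \<alpha> \<ge> - 1 / 2 makes the factor in front of \<open>D (Suc n)\<close> at most
  1.\<close>

lemma q_dunkl_eigen_zero:
  assumes q: "0 < q" "q < 1" and \<alpha>: "\<alpha> \<ge> - 1 / 2"
    and eq: "\<forall>x\<in>Rq q. q_dunkl_op \<alpha> q f x = \<i> * l * f x"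
    and lim: "(f \<longlongrightarrow> 0) (at 0 within Rq q)"
    and x: "x \<in> Rq q"
  shows "f x = 0"
proof -
  have mem: "q ^ n * x \<in> Rq q" for n
    using Rq_mult_powi[OF q(1) x, of "int n"] by simp
  have xn: "(\<lambda>n. q ^ n * x) \<longlonglongrightarrow> 0"
    using q by (intro tendsto_mult_left_zero LIMSEQ_power_zero) auto
  \<comment> \<open>Both signs are needed, since the even and odd parts at \<open>q ^ n * x\<close>
    also involve the reflected point.\<close>
  have f1: "(\<lambda>n. f (s * (q ^ n * x))) \<longlonglongrightarrow> 0" if "s = 1 \<or> s = - 1" for s
  proof (rule filterlim_compose[OF lim], unfold filterlim_at, intro conjI always_eventually allI)
    show "(\<lambda>n. s * (q ^ n * x)) \<longlonglongrightarrow> 0" using tendsto_mult_right_zero[OF xn] .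
    show "s * (q ^ n * x) \<in> Rq q" "s * (q ^ n * x) \<noteq> 0" for n
      using that mem[of n] Rq_minus[OF mem[of n]] Rq_nonzero[OF q(1) mem[of n]] by auto
  qed
  have lims: "(\<lambda>n. f (q ^ n * x)) \<longlonglongrightarrow> 0" "(\<lambda>n. f (- (q ^ n * x))) \<longlonglongrightarrow> 0"
    using f1[of 1] f1[of "- 1"] by simp_all
  define E where "E n = even_part f (q ^ n * x)" for n
  define D where "D n = odd_part f (q ^ n * x)" for n
  define m where "m = \<i> * l * of_real ((1 - q) * x)"
  have limE: "E \<longlonglongrightarrow> (0 + 0) / 2" unfolding E_def even_part_def by (intro tendsto_intros lims) auto
  have limD: "D \<longlonglongrightarrow> (0 - 0) / 2" unfolding D_def odd_part_def by (intro tendsto_intros lims) auto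
  have recE: "E n = E (Suc n) + m * of_real q ^ Suc n * D (Suc n)" for n
  proof -
    \<comment> \<open>The even equation is used at \<open>q ^ Suc n * x\<close>, so that its
      backward point is \<open>q ^ n * x\<close>; the odd equation is used at
      \<open>q ^ n * x\<close>.\<close>
    have "q ^ Suc n * x / q = q ^ n * x" using q by simp
    then show ?thesis
      using bspec[OF iffD1[OF q_dunkl_eigen_iff[OF q] eq] mem[of "Suc n"]] unfolding E_def D_def m_def
      by (simp add: algebra_simps)
  qed
  have recD: "D n = of_real (q powr (2 * \<alpha> + 1)) * D (Suc n) + m * of_real q ^ n * E n" for n
  proof -
    have "q * (q ^ n * x) = q ^ Suc n * x" by simp
    then show ?thesis
      using bspec[OF iffD1[OF q_dunkl_eigen_iff[OF q] eq] mem[of n]] unfolding E_def D_def m_def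
      by (simp add: algebra_simps)
  qed
  have Q: "norm (complex_of_real (q powr (2 * \<alpha> + 1))) \<le> 1"
    using q \<alpha> powr_mono'[of 0 "2 * \<alpha> + 1" q] by simp
  have "E \<longlonglongrightarrow> 0" "D \<longlonglongrightarrow> 0" using limE limD by simp_all
  then have "E 0 = 0" "D 0 = 0"
    by (rule backward_q_system_zero[OF q Q recE recD])+
  then show ?thesis using even_plus_odd_part[of f x] by (simp add: E_def D_def)
qed

lemma q_dunkl_op_diff:
  "q_dunkl_op \<alpha> q (\<lambda>x. f x - g x) x = q_dunkl_op \<alpha> q f x - q_dunkl_op \<alpha> q g x"
proof -
  have "q_dunkl_H \<alpha> q (\<lambda>x. f x - g x) = (\<lambda>x. q_dunkl_H \<alpha> q f x - q_dunkl_H \<alpha> q g x)"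
    by (simp add: fun_eq_iff q_dunkl_H_def even_part_def odd_part_def algebra_simps diff_divide_distrib add_divide_distrib)
  moreover have "q_deriv q (\<lambda>x. F x - G x) x = q_deriv q F x - q_deriv q G x" for F G
    unfolding q_deriv_def diff_divide_distrib[symmetric] by (rule arg_cong2[of _ _ _ _ "(/)"]) (simp_all add: algebra_simps)
  moreover have "(f x - g x - (f (- x) - g (- x))) / of_real (2 * x)
      = (f x - f (- x)) / of_real (2 * x) - (g x - g (- x)) / of_real (2 * x)"
    unfolding diff_divide_distrib[symmetric] by (simp add: algebra_simps)
  ultimately show ?thesis
    unfolding q_dunkl_op_def by (simp only: right_diff_distrib) simp
qed

text \<open>Uniqueness is agreement on \<open>Rq q\<close>, which is equality of the functions that
  the total functions represent.\<close>

theorem theorem4: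
  fixes q \<alpha> :: real and l :: complex
  assumes "0 < q" and "q < 1"
    and "\<exists>k::int. ln (1 - q) / ln q = 2 * of_int k"
    and "\<alpha> \<ge> - 1 / 2"
  shows "q_dunkl_solution \<alpha> q l (q_dunkl_kernel \<alpha> q l)
    \<and> (\<forall>f. q_dunkl_solution \<alpha> q l f \<longrightarrow> (\<forall>x\<in>Rq q. f x = q_dunkl_kernel \<alpha> q l x))"
proof (intro conjI allI impI ballI)
  let ?\<psi> = "q_dunkl_kernel \<alpha> q l"
  show sol: "q_dunkl_solution \<alpha> q l ?\<psi>"
    using assms by (intro q_dunkl_kernel_solution) auto
  fix f x assume f: "q_dunkl_solution \<alpha> q l f" and x: "x \<in> Rq q"
  \<comment> \<open>By linearity the difference of two solutions satisfies the same equation, and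
    the normalizations at 0 cancel to the limit 0.\<close>
  have "f x - ?\<psi> x = 0"
  proof (rule q_dunkl_eigen_zero[OF assms(1,2,4) _ _ x])
    show "\<forall>x\<in>Rq q. q_dunkl_op \<alpha> q (\<lambda>x. f x - ?\<psi> x) x = \<i> * l * (f x - ?\<psi> x)"
      using f sol by (simp add: q_dunkl_op_diff q_dunkl_solution_def right_diff_distrib)
    show "((\<lambda>x. f x - ?\<psi> x) \<longlongrightarrow> 0) (at 0 within Rq q)"
      using f sol tendsto_diff[of f 1 _ ?\<psi> 1] by (simp add: q_dunkl_solution_def)
  qed
  then show "f x = ?\<psi> x" by simp
qed

end
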